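(* Let $H$ be a fixed graph that is not a linear forest all of whose components are paths of length at most $1$. Then any streaming algorithm for \textsc{Connectivity} in the AL model that uses $p$ passes over the stream must use $\Omega(n/p)$ bits of memory on $n$-vertex graphs $G$, even when the algorithm is given a set $X \subseteq V(G)$ of constant size such that $G - X$ is $H$-free.
   Context: Graphs are finite, simple, undirected. A linear forest is a disjoint union of paths; the length of a path is its number of edges. $G$ is $H$-free if it has no induced subgraph isomorphic to $H$; $G-X$ is $G$ with the vertices of $X$ deleted. \textsc{Connectivity}: decide whether $G$ is connected. In the Adjacency List (AL) streaming model the graph arrives as a sequence of vertices in arbitrary fixed order, each together with the full list of its incident edges (each edge appears twice). A $p$-pass algorithm reads the sequence $p$ times with unlimited computation; memory is measured in bits. "Must use $\Omega(f)$ bits" means there is a constant $c>0$ such that every $p$-pass algorithm solving the problem correctly on all inputs of the stated class uses at least $c\cdot f$ bits on some $n$-vertex input, for all sufficiently large $n$ and all $p$. *)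

theory Defs
  imports Complex_Main "Graph_Theory.Graph_Theory"
begin

section \<open>Graphs\<close>

text \<open>
  As in the AFP entry Graph_Theory, a finite simple undirected graph is a finite, loop-free
  symmetric digraph without parallel arcs (locale graph, or pair_graph when arcs are pairs): the
  undirected edge between u and v is the pair of arcs (u,v) and (v,u). Strong connectivity is then
  connectivity, and sccs is the set of connected components.
\<close>

definition path_graph :: "nat \<Rightarrow> nat pair_pre_digraph" where
  "path_graph l = \<lparr> pverts = {..l},
     parcs = {(i, j). i \<le> l \<and> j \<le> l \<and> (j = Suc i \<or> i = Suc j)} \<rparr>"

definition is_path_of_length :: "('a, 'b) pre_digraph \<Rightarrow> nat \<Rightarrow> bool" where
  "is_path_of_length C l \<longleftrightarrow> digraph_iso C (with_proj (path_graph l))"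

definition linear_forest :: "('a, 'b) pre_digraph \<Rightarrow> bool" where
  "linear_forest G \<longleftrightarrow> (\<forall>C \<in> pre_digraph.sccs G. \<exists>l. is_path_of_length C l)"

definition free_of :: "('h, 'e) pre_digraph \<Rightarrow> ('a, 'b) pre_digraph \<Rightarrow> bool" where
  "free_of H G \<longleftrightarrow> \<not> (\<exists>K. induced_subgraph K G \<and> digraph_iso K H)"

definition delete_verts :: "('a, 'b) pre_digraph \<Rightarrow> 'a set \<Rightarrow> ('a, 'b) pre_digraph" where
  "delete_verts G X = G \<restriction> (verts G - X)"


section \<open>Adjacency list streams\<close>

text \<open>
  One stream item is a vertex v with the list of its incident edges, each written as the arc
  leaving v. Thus an edge occurs twice in a stream, once in each direction.
\<close>

type_synonym al_item = "nat \<times> (nat \<times> nat) list"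

definition is_al_stream :: "nat pair_pre_digraph \<Rightarrow> al_item list \<Rightarrow> bool" where
  "is_al_stream G s \<longleftrightarrow>
     distinct (map fst s) \<and> set (map fst s) = pverts G \<and>
     (\<forall>(v, es) \<in> set s. distinct es \<and> set es = out_arcs (with_proj G) v)"


section \<open>Streaming algorithms\<close>

text \<open>
  A deterministic multi-pass algorithm with unlimited computation: three arbitrary functions acting
  on a memory content, which is a bit string. The set X is read-only input, and an item is processed
  with knowledge of the number of the current pass and of the position in it; none of this is
  charged as memory. Memory is measured only between consecutive items. All these choices
  favour the algorithm, so they only make a lower bound stronger.
\<close>

record stream_alg =
  alg_init :: "nat set \<Rightarrow> bool list"
  alg_step :: "nat set \<Rightarrow> nat \<Rightarrow> nat \<Rightarrow> al_item \<Rightarrow> bool list \<Rightarrow> bool list"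
  alg_output :: "nat set \<Rightarrow> bool list \<Rightarrow> bool"

text \<open>
  The memory after t items have been read in total. Item number t (from 0) is read in pass
  t div length s at position t mod length s, and every pass reads the same sequence s.
\<close>

primrec memory_at :: "stream_alg \<Rightarrow> nat set \<Rightarrow> al_item list \<Rightarrow> nat \<Rightarrow> bool list" where
  "memory_at A X s 0 = alg_init A X"
| "memory_at A X s (Suc t) =
     alg_step A X (t div length s) (t mod length s) (s ! (t mod length s)) (memory_at A X s t)"

definition result :: "stream_alg \<Rightarrow> nat \<Rightarrow> nat set \<Rightarrow> al_item list \<Rightarrow> bool" where
  "result A p X s = alg_output A X (memory_at A X s (p * length s))"

definition bits_used :: "stream_alg \<Rightarrow> nat \<Rightarrow> nat set \<Rightarrow> al_item list \<Rightarrow> nat" where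
  "bits_used A p X s = Max ((\<lambda>t. length (memory_at A X s t)) ` {..p * length s})"


section \<open>Connectivity with a given deletion set\<close>

definition instances ::
  "('h, 'e) pre_digraph \<Rightarrow> nat \<Rightarrow> nat \<Rightarrow> (nat pair_pre_digraph \<times> nat set \<times> al_item list) set" where
  "instances H k n = {(G, X, s).
     pair_graph G \<and> pverts G = {..<n} \<and>
     X \<subseteq> pverts G \<and> card X = k \<and> free_of H (delete_verts (with_proj G) X) \<and>
     is_al_stream G s}"

text \<open>
  The name connected is qualified because it also denotes topological connectedness.
\<close>

definition solves_connectivity ::
  "stream_alg \<Rightarrow> nat \<Rightarrow> (nat pair_pre_digraph \<times> nat set \<times> al_item list) set \<Rightarrow> bool" where
  "solves_connectivity A p I \<longleftrightarrow>
     (\<forall>(G, X, s) \<in> I. result A p X s = Digraph_Component.connected (with_proj G))"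

end

theory Submission
  imports Defs
begin

text \<open>
  Some vertex of H has two neighbours, so every graph of maximum degree at most one is H-free.
  Disjointness of two sets S and T can be encoded in a graph that becomes a matching once the two
  vertices 0 and 1 are deleted, where all lists of even vertices are determined by S and all lists of
  odd vertices by T. Streaming the even vertices first, the memory contents at the half-way points
  and ends of the p passes form a transcript of a protocol for disjointness. The pairs of a set
  and its complement are a fooling set: if two of them had the same transcript, exchanging their
  halves would not change the output. So there are at least 2^(n/2 - O(1)) transcripts, each of
  which consists of 2p memory contents.
\<close>

section \<open>Graphs of maximum degree at most one\<close>

text \<open>Without parallel arcs an arc is determined by its pair of ends, so an injective vertex
  map induces the arc map of an isomorphism.\<close>

lemma digraph_iso_with_projI:
  assumes "nomulti_digraph C" "inj_on g (verts C)" "g ` verts C = pverts P"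
    and "map_prod g g ` arcs_ends C = parcs P"
  shows "digraph_iso C (with_proj P)"
proof -
  interpret nomulti_digraph C by fact
  let ?f = "\<lparr>iso_verts = g, iso_arcs = (\<lambda>e. (g (tail C e), g (head C e))),
    iso_head = snd, iso_tail = fst\<rparr>"
  have "inj_on (\<lambda>e. (g (tail C e), g (head C e))) (arcs C)"
    by (auto intro!: inj_onI no_multi_arcs simp: arc_to_ends_def inj_on_eq_iff[OF assms(2)])
  then have "digraph_isomorphism ?f"
    using assms(2) wf_digraph by (simp add: digraph_isomorphism_def)
  moreover have "with_proj P = app_iso ?f C"
    using assms(3,4) by (simp add: app_iso_def with_proj_def arcs_ends_conv image_image)
  ultimately show ?thesis unfolding digraph_iso_def by blast
qed

text \<open>If v has a neighbour x, then by symmetry v is the only neighbour of x, so no walk from v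
  leaves {v, x}. A component is thus a single vertex or a single edge.\<close>

lemma path_components_if_unique_neighbours:
  assumes "graph H" and unique: "\<And>v a b. v \<rightarrow>\<^bsub>H\<^esub> a \<Longrightarrow> v \<rightarrow>\<^bsub>H\<^esub> b \<Longrightarrow> a = b"
    and C: "C \<in> pre_digraph.sccs H"
  shows "\<exists>l\<le>1. is_path_of_length C l"
proof -
  interpret H: graph H by fact
  have ind: "induced_subgraph C H" and sc: "strongly_connected C"
    using C by auto
  then have sub: "subgraph C H" by auto
  interpret C: wf_digraph C using sub by auto
  have compat: "tail C = tail H" "head C = head H"
    using sub by (auto simp: subgraph_def compatible_def)
  have arcs_C: "arcs C = {e \<in> arcs H. tail H e \<in> verts C \<and> head H e \<in> verts C}"
    using ind by auto
  have nomulti: "nomulti_digraph C"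
    by unfold_locales
      (use H.no_multi_arcs in \<open>auto simp: arcs_C compat arc_to_ends_def\<close>)
  have ends_C: "arcs_ends C = {(u, w). u \<rightarrow>\<^bsub>H\<^esub> w \<and> u \<in> verts C \<and> w \<in> verts C}"
    unfolding arcs_ends_conv compat arcs_C by auto
  have sym_H: "\<And>u w. u \<rightarrow>\<^bsub>H\<^esub> w \<Longrightarrow> w \<rightarrow>\<^bsub>H\<^esub> u"
    using H.sym_arcs by (rule arcs_ends_symmetric)
  obtain v where v: "v \<in> verts C" using sc by (auto simp: strongly_connected_def)
  show ?thesis
  proof (cases "verts C = {v}")
    case True
    have "arcs_ends C = {}"
      unfolding ends_C True using H.adj_not_same by auto
    then have "digraph_iso C (with_proj (path_graph 0))"
      by (intro digraph_iso_with_projI[where g = "\<lambda>_. 0"] nomulti)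
        (auto simp: True path_graph_def)
    then show ?thesis by (auto simp: is_path_of_length_def)
  next
    case False
    then obtain w where w: "w \<in> verts C" "w \<noteq> v" using v by auto
    then have "v \<rightarrow>\<^sup>*\<^bsub>C\<^esub> w" using sc v by auto
    then obtain x where x: "v \<rightarrow>\<^bsub>C\<^esub> x"
      using w by (cases rule: C.converse_reachable_cases) auto
    then have vx: "v \<rightarrow>\<^bsub>H\<^esub> x" "x \<in> verts C" by (auto simp: ends_C)
    then have "x \<noteq> v" using H.adj_not_same by auto
    have "u \<in> {v, x}" if "v \<rightarrow>\<^sup>*\<^bsub>C\<^esub> u" for u
      using that
    proof (induct rule: C.reachable_induct)
      case (step y z)
      then have "y \<rightarrow>\<^bsub>H\<^esub> z" by (simp add: ends_C)
      then show ?case using step(3) vx(1) sym_H[OF vx(1)] unique by blast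
    qed simp
    then have verts_C: "verts C = {v, x}"
      using sc v vx(2) by (auto simp: strongly_connected_def)
    have "arcs_ends C = {(v, x), (x, v)}"
      unfolding ends_C verts_C using vx(1) sym_H[OF vx(1)] H.adj_not_same by auto
    moreover have "path_graph 1 = \<lparr>pverts = {0, 1}, parcs = {(0, 1), (1, 0)}\<rparr>"
      by (auto simp: path_graph_def)
    ultimately have "digraph_iso C (with_proj (path_graph 1))"
      using \<open>x \<noteq> v\<close>
      by (intro digraph_iso_with_projI[where g = "\<lambda>u. if u = v then 0 else 1"] nomulti)
        (simp_all add: verts_C insert_commute)
    then show ?thesis by (auto simp: is_path_of_length_def)
  qed
qed

text \<open>Pulled back along an isomorphism, two distinct neighbours of one vertex of H stay
  distinct neighbours of one vertex of the copy, hence of G.\<close>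

lemma free_of_if_unique_neighbours:
  assumes unique: "\<And>v a b. v \<rightarrow>\<^bsub>G\<^esub> a \<Longrightarrow> v \<rightarrow>\<^bsub>G\<^esub> b \<Longrightarrow> a = b"
    and H: "v \<rightarrow>\<^bsub>H\<^esub> a" "v \<rightarrow>\<^bsub>H\<^esub> b" "a \<noteq> b"
  shows "free_of H G"
  unfolding free_of_def
proof (rule notI, elim exE conjE)
  fix K assume K: "induced_subgraph K G" "digraph_iso K H"
  then have sub: "subgraph K G" by auto
  then interpret K: wf_digraph K by auto
  obtain f where f: "K.digraph_isomorphism f" "H = app_iso f K"
    using K(2) by (auto simp: digraph_iso_def)
  then have "arcs_ends H = (\<lambda>(u, v). (iso_verts f u, iso_verts f v)) ` arcs_ends K"
    by (simp add: K.arcs_ends_app_iso_eq)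
  then obtain v1 a' v2 b' where ab: "v1 \<rightarrow>\<^bsub>K\<^esub> a'" "v2 \<rightarrow>\<^bsub>K\<^esub> b'"
    and eqs: "v = iso_verts f v1" "v = iso_verts f v2" "a = iso_verts f a'" "b = iso_verts f b'"
    using H(1,2) by auto
  have "v1 \<in> verts K" "v2 \<in> verts K" using ab by (auto dest: K.adj_in_verts)
  then have "v1 = v2" using eqs(1,2) f(1) K.iso_verts_eq_iff by metis
  then have "a' = b'" using ab arcs_ends_mono[OF sub] unique by blast
  then show False using eqs H(3) by simp
qed

section \<open>Communication lower bound for streaming algorithms\<close>

text \<open>
  A stream is split as a @ b. The memory contents at the half-way point and at the end of every pass
  are the transcript of a two-party protocol in which one party holds a and the other one b.
\<close>

definition transcript :: "stream_alg \<Rightarrow> nat \<Rightarrow> nat set \<Rightarrow> al_item list \<Rightarrow> al_item list \<Rightarrow> bool list list"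
  where "transcript A p X a b = map (\<lambda>k. memory_at A X (a @ b) (k * length (a @ b) + length a)) [0..<p]
      @ map (\<lambda>k. memory_at A X (a @ b) (Suc k * length (a @ b))) [0..<p]"

lemma length_transcript [simp]: "length (transcript A p X a b) = 2 * p"
  by (simp add: transcript_def)

lemma memory_at_cong:
  assumes "length s = length s'" "i + j \<le> length s"
    and "memory_at A X s (k * length s + i) = memory_at A X s' (k * length s + i)"
    and "\<And>r. i \<le> r \<Longrightarrow> r < i + j \<Longrightarrow> s ! r = s' ! r"
  shows "memory_at A X s (k * length s + (i + j)) = memory_at A X s' (k * length s + (i + j))"
  using assms(2,4)
proof (induct j)
  case 0
  then show ?case using assms(3) by simp
next
  case (Suc j)
  \<comment> \<open>Here i + j is still below \<open>length s\<close>, so the next item belongs to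
    pass k.\<close>
  then have "(k * length s + (i + j)) mod length s = i + j" by simp
  then show ?case using Suc assms(1) by simp
qed

text \<open>Cut and paste: the mixed run on a @ b' starts a pass like the run on a @ b and follows
  it through a. Half-way, equal transcripts let it continue as the run on a' @ b' through b', and at
  the end of the pass they lead back to the run on a @ b.\<close>

lemma memory_at_crossing:
  assumes len: "length a = length a'" "length b = length b'"
    and tr: "transcript A p X a b = transcript A p X a' b'" and "k \<le> p"
  shows "memory_at A X (a @ b') (k * length (a @ b)) = memory_at A X (a @ b) (k * length (a @ b))"
  using \<open>k \<le> p\<close>
proof (induct k)
  case (Suc k)
  let ?n = "length (a @ b)"
  have ks: "k \<in> set [0..<p]" using Suc.prems by simp
  have mid: "memory_at A X (a @ b) (k * ?n + length a) = memory_at A X (a' @ b') (k * ?n + length a)"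
    and fin: "memory_at A X (a @ b) (Suc k * ?n) = memory_at A X (a' @ b') (Suc k * ?n)"
    using tr ks len by (auto simp: transcript_def)
  have "memory_at A X (a @ b') (k * ?n + (0 + length a))
      = memory_at A X (a @ b) (k * ?n + (0 + length a))"
    using memory_at_cong[of "a @ b'" "a @ b" 0 "length a" A X k] Suc len
    by (simp add: nth_append)
  then have "memory_at A X (a @ b') (k * ?n + length a)
      = memory_at A X (a' @ b') (k * ?n + length a)"
    using mid by simp
  then have "memory_at A X (a @ b') (k * ?n + (length a + length b))
      = memory_at A X (a' @ b') (k * ?n + (length a + length b))"
    using memory_at_cong[of "a @ b'" "a' @ b'" "length a" "length b" A X k] len
    by (simp add: nth_append)
  then show ?case using fin by (simp add: algebra_simps)
qed simp

section \<open>Lengths and number of transcripts\<close>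

lemma length_memory_at_le_bits_used:
  "t \<le> p * length s \<Longrightarrow> length (memory_at A X s t) \<le> bits_used A p X s"
  unfolding bits_used_def by (rule Max_ge) auto

lemma length_transcript_le:
  assumes "c \<in> set (transcript A p X a b)"
  shows "length c \<le> bits_used A p X (a @ b)"
proof -
  have "Suc k * length (a @ b) \<le> p * length (a @ b)" if "k < p" for k
    using that by (intro mult_right_mono) auto
  then have "k * length (a @ b) + length a \<le> p * length (a @ b)"
    "Suc k * length (a @ b) \<le> p * length (a @ b)" if "k < p" for k
    using that[THEN \<open>\<And>k. k < p \<Longrightarrow> _\<close>] by auto
  then show ?thesis
    using assms unfolding transcript_def by (auto intro: length_memory_at_le_bits_used)
qed

lemma finite_bool_lists: "finite {xs :: bool list. length xs \<le> s}"
  using finite_lists_length_le[of "UNIV :: bool set" s] by simp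

text \<open>The bound 4^s in place of 2^(s+1) is what makes the estimate nontrivial for s = 0.\<close>

lemma card_bool_lists_le: "card {xs :: bool list. length xs \<le> s} \<le> 4 ^ s"
proof -
  have "card {xs :: bool list. length xs \<le> s} = (\<Sum>i\<le>s. 2 ^ i)"
    using card_lists_length_le[of "UNIV :: bool set" s] by simp
  also have "\<dots> \<le> 4 ^ s"
  proof (induct s)
    case (Suc s)
    then show ?case using power_mono[of "2 :: nat" 4 s] by simp
  qed simp
  finally show ?thesis .
qed

lemma fooling_set_bound:
  assumes len: "\<And>x y. x \<in> F \<Longrightarrow> y \<in> F \<Longrightarrow> length (a x) = length (a y) \<and> length (b x) = length (b y)"
    and diag: "\<And>x. x \<in> F \<Longrightarrow> result A p X (a x @ b x)"
    and cross: "\<And>x y. x \<in> F \<Longrightarrow> y \<in> F \<Longrightarrow> x \<noteq> y \<Longrightarrow>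
      \<not> (result A p X (a x @ b y) \<and> result A p X (a y @ b x))"
    and bits: "\<And>x. x \<in> F \<Longrightarrow> bits_used A p X (a x @ b x) \<le> s"
  shows "card F \<le> 2 ^ (4 * p * s)"
proof -
  let ?B = "{xs :: bool list. length xs \<le> s}"
  let ?L = "{cs. set cs \<subseteq> ?B \<and> length cs = 2 * p}"
  let ?tr = "\<lambda>x. transcript A p X (a x) (b x)"
  have half: "result A p X (a x @ b y)" if "x \<in> F" "y \<in> F" "?tr x = ?tr y" for x y
    using memory_at_crossing[OF conjunct1[OF len] conjunct2[OF len] that(3) order_refl]
      that len[OF that(1,2)] diag[OF that(1)]
    by (simp add: result_def)
  \<comment> \<open>Equal transcripts would make both exchanged inputs accepted, by
    \<open>half\<close> for (x, y) and for (y, x).\<close>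
  have "inj_on ?tr F"
    using half cross by (intro inj_onI) metis
  moreover have "?tr ` F \<subseteq> ?L"
    by (auto intro: order_trans[OF length_transcript_le bits])
  moreover have "finite ?L"
    using finite_lists_length_eq[OF finite_bool_lists] .
  ultimately have "card F \<le> card ?L" by (rule card_inj_on_le)
  also have "\<dots> = card ?B ^ (2 * p)"
    by (rule card_lists_length_eq[OF finite_bool_lists])
  also have "\<dots> \<le> (4 ^ s) ^ (2 * p)"
    by (rule power_mono[OF card_bool_lists_le]) simp
  also have "\<dots> = ((2 ^ 2) ^ s) ^ (2 * p)" by simp
  also have "\<dots> = 2 ^ (4 * p * s)"
    by (simp only: power_mult[symmetric]) (simp add: mult.commute mult.left_commute)
  finally show ?thesis .
qed

section \<open>Encoding set disjointness\<close>

text \<open>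
  For i > 0 the vertices 2i and 2i+1 are joined, 2i is joined to 0 unless i lies in S, and 2i+1 is
  joined to 1 unless i lies in T. So this pair is cut off from 0 and 1 iff i lies in both sets. For
  odd n the last vertex has no partner; it is joined to 0 because S stays below n div 2.
\<close>

definition linked :: "nat set \<Rightarrow> nat \<Rightarrow> nat \<Rightarrow> bool" where
  "linked D v w \<longleftrightarrow> v \<noteq> w \<and> (v div 2 = w div 2 \<or>
     even v = even w \<and> (v div 2 = 0 \<and> w div 2 \<notin> D \<or> w div 2 = 0 \<and> v div 2 \<notin> D))"

definition disj_graph :: "nat \<Rightarrow> nat set \<Rightarrow> nat set \<Rightarrow> nat pair_pre_digraph" where
  "disj_graph n S T = \<lparr>pverts = {..<n},
     parcs = {(v, w). v < n \<and> w < n \<and> linked (if even v then S else T) v w}\<rparr>"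

definition disj_stream :: "nat \<Rightarrow> nat set \<Rightarrow> nat list \<Rightarrow> al_item list" where
  "disj_stream n D vs = map (\<lambda>v. (v, map (Pair v) (filter (linked D v) [0..<n]))) vs"

text \<open>The two directions of an edge are governed by the same set: the clause of
  \<open>linked\<close> that mentions D requires equal parity.\<close>

lemma pair_graph_disj_graph: "pair_graph (disj_graph n S T)"
proof -
  have "finite (parcs (disj_graph n S T))"
    by (rule finite_subset[of _ "{..<n} \<times> {..<n}"]) (auto simp: disj_graph_def)
  moreover have "sym (parcs (disj_graph n S T))"
    by (auto simp: sym_def disj_graph_def linked_def split: if_splits)
  ultimately show ?thesis
    by unfold_locales (auto simp: disj_graph_def symmetric_def linked_def)
qed

lemma is_al_stream_disj:
  "is_al_stream (disj_graph n S T)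
     (disj_stream n S (filter even [0..<n]) @ disj_stream n T (filter odd [0..<n]))"
proof -
  have "map fst (disj_stream n D vs) = vs" for D vs
    by (simp add: disj_stream_def o_def)
  moreover have "distinct (map (Pair v) (filter P [0..<n]))" for v :: nat and P
    by (simp add: distinct_map inj_on_def)
  ultimately show ?thesis
    by (auto simp: is_al_stream_def disj_graph_def disj_stream_def out_arcs_def)
qed

text \<open>The edges that depend on S or T all end in 0 or 1. Deleting these leaves only the edges
  between partners 2i and 2i+1.\<close>

lemma unique_neighbours_disj_graph:
  assumes "v \<rightarrow>\<^bsub>delete_verts (with_proj (disj_graph n S T)) {0, 1}\<^esub> a"
    and "v \<rightarrow>\<^bsub>delete_verts (with_proj (disj_graph n S T)) {0, 1}\<^esub> b"
  shows "a = b"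
proof -
  have "w = (if even v then Suc v else v - 1)"
    if "v \<rightarrow>\<^bsub>delete_verts (with_proj (disj_graph n S T)) {0, 1}\<^esub> w" for w
  proof -
    have "linked (if even v then S else T) v w" "v \<noteq> 0" "v \<noteq> 1" "w \<noteq> 0" "w \<noteq> 1"
      using that by (auto simp: delete_verts_def disj_graph_def arcs_ends_conv)
    then have "v div 2 = w div 2" "v \<noteq> w" by (auto simp: linked_def)
    then show ?thesis by (auto elim!: evenE oddE)
  qed
  from this[OF assms(1)] this[OF assms(2)] show ?thesis by simp
qed

lemma connected_disj_graph_iff:
  assumes "2 \<le> n" "S \<subseteq> {..<n div 2}" "0 \<notin> S"
  shows "Digraph_Component.connected (with_proj (disj_graph n S T)) \<longleftrightarrow> S \<inter> T = {}"
proof -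
  let ?G = "disj_graph n S T"
  interpret pair_graph ?G by (rule pair_graph_disj_graph)
  \<comment> \<open>\<open>connected\<close> refers to the symmetric closure, which changes nothing
    here.\<close>
  have "mk_symmetric (with_proj ?G) = ?G"
    by (rule pair_pre_digraph.equality) (auto simp: parcs_mk_symmetric intro: arcs_symmetric)
  then have conn: "Digraph_Component.connected (with_proj ?G) \<longleftrightarrow> strongly_connected (with_proj ?G)"
    by (simp add: connected_def)
  have verts: "pverts ?G = {..<n}" by (simp add: disj_graph_def)
  show ?thesis
  proof
    assume "Digraph_Component.connected (with_proj ?G)"
    then have reach: "\<And>u v. u < n \<Longrightarrow> v < n \<Longrightarrow> u \<rightarrow>\<^sup>*\<^bsub>with_proj ?G\<^esub> v"
      unfolding conn strongly_connected_def by (simp add: verts)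
    show "S \<inter> T = {}"
    proof (rule ccontr)
      assume "S \<inter> T \<noteq> {}"
      then obtain i where i: "i \<in> S" "i \<in> T" by auto
      then have "i < n div 2" "i \<noteq> 0" using assms by (blast, metis)
      then have "2 * i < n" "0 < n" by auto
      \<comment> \<open>No edge leaves the pair {2i, 2i+1} if i lies in both sets.\<close>
      have "u div 2 = i" if "(2 * i) \<rightarrow>\<^sup>*\<^bsub>with_proj ?G\<^esub> u" for u
        using that
      proof (induct rule: reachable_induct)
        case (step x y)
        then show ?case using i \<open>i \<noteq> 0\<close>
          by (auto simp: disj_graph_def linked_def split: if_splits)
      qed simp
      from this[OF reach[OF \<open>2 * i < n\<close> \<open>0 < n\<close>]] show False using \<open>i \<noteq> 0\<close> by simp
    qed
  next
    assume disj: "S \<inter> T = {}"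
    have link: "v \<rightarrow>\<^sup>*\<^bsub>with_proj ?G\<^esub> w"
      if "v < n" "w < n" "linked (if even v then S else T) v w" for v w
    proof -
      have "v \<rightarrow>\<^bsub>with_proj ?G\<^esub> w" using that by (simp add: disj_graph_def)
      then show ?thesis by (rule reachable_adjI[unfolded with_proj_simps(3)[symmetric]])
    qed
    have even0: "u \<rightarrow>\<^sup>*\<^bsub>with_proj ?G\<^esub> 0" if "u < n" "even u" "u div 2 \<notin> S" for u
      using that link[of u 0] assms(1) verts by (cases "u = 0") (auto simp: linked_def)
    have one: "1 \<rightarrow>\<^sup>*\<^bsub>with_proj ?G\<^esub> 0"
      using link[of 1 0] assms(1) by (simp add: linked_def)
    have odd0: "u \<rightarrow>\<^sup>*\<^bsub>with_proj ?G\<^esub> 0" if "u < n" "odd u" "u div 2 \<notin> T" for u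
    proof (cases "u = 1")
      case False
      then have "u \<rightarrow>\<^sup>*\<^bsub>with_proj ?G\<^esub> 1"
        using that link[of u 1] assms(1) by (auto simp: linked_def)
      then show ?thesis using one by (rule reachable_trans)
    qed (use one in simp)
    have root: "u \<rightarrow>\<^sup>*\<^bsub>with_proj ?G\<^esub> 0" if "u < n" for u
    proof -
      \<comment> \<open>In the first two cases u reaches its own hub, 0 or 1; in the last two its
        partner does, since S and T are disjoint.\<close>
      consider "even u" "u div 2 \<notin> S" | "odd u" "u div 2 \<notin> T"
        | "even u" "u div 2 \<in> S" "u div 2 \<notin> T" | "odd u" "u div 2 \<in> T" "u div 2 \<notin> S"
        using disj by blast
      then show ?thesis
      proof cases
        case 3
        \<comment> \<open>The bound on S ensures that the partner of u exists, even for odd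
          n.\<close>
        then have "u div 2 < n div 2" using assms(2) by auto
        then have "Suc u < n" using 3 by presburger
        moreover have "Suc u div 2 = u div 2" using 3 by presburger
        ultimately have "u \<rightarrow>\<^sup>*\<^bsub>with_proj ?G\<^esub> Suc u" "Suc u \<rightarrow>\<^sup>*\<^bsub>with_proj ?G\<^esub> 0"
          using 3 that by (auto intro!: link odd0 simp: linked_def)
        then show ?thesis by (rule reachable_trans)
      next
        case 4
        then have "(u - 1) div 2 = u div 2" "u - 1 \<noteq> u" "even (u - 1)" "u - 1 < n"
          using that by (presburger, presburger, presburger, presburger)
        then have "u \<rightarrow>\<^sup>*\<^bsub>with_proj ?G\<^esub> (u - 1)" "(u - 1) \<rightarrow>\<^sup>*\<^bsub>with_proj ?G\<^esub> 0"
          using 4 that by (auto intro!: link even0 simp: linked_def)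
        then show ?thesis by (rule reachable_trans)
      qed (use that even0 odd0 in auto)
    qed
    have "u \<rightarrow>\<^sup>*\<^bsub>with_proj ?G\<^esub> v" if "u < n" "v < n" for u v
      using root[OF that(1)] symmetric_reachable'[OF root[OF that(2)]] by (rule reachable_trans)
    then show "Digraph_Component.connected (with_proj ?G)"
      unfolding conn strongly_connected_def using assms(1) by (auto simp: verts lessThan_empty_iff)
  qed
qed

section \<open>The lower bound for connectivity\<close>

theorem theorem6:
  fixes H :: "('h, 'e) pre_digraph"
  assumes "graph H"
    and "\<not> (linear_forest H \<and> (\<forall>C \<in> pre_digraph.sccs H. \<exists>l\<le>1. is_path_of_length C l))"
  shows "\<exists>k :: nat. \<exists>c :: real. c > 0 \<and> (\<exists>n0 :: nat. \<forall>n\<ge>n0. \<forall>p\<ge>1. \<forall>A :: stream_alg.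
           solves_connectivity A p (instances H k n) \<longrightarrow>
           (\<exists>(G, X, s) \<in> instances H k n. real (bits_used A p X s) \<ge> c * (real n / real p)))"
proof -
  have "\<exists>v a b. v \<rightarrow>\<^bsub>H\<^esub> a \<and> v \<rightarrow>\<^bsub>H\<^esub> b \<and> a \<noteq> b"
    using assms(2) path_components_if_unique_neighbours[OF assms(1)]
    unfolding linear_forest_def by metis
  then obtain v a b where vab: "v \<rightarrow>\<^bsub>H\<^esub> a" "v \<rightarrow>\<^bsub>H\<^esub> b" "a \<noteq> b" by blast
  \<comment> \<open>The deletion set consists of the two hubs. The factor 32 is 4 * 8: a transcript
    is 2p strings with at most 4^s choices each, giving exponent 4ps, and 8 covers passing from n to
    the number of usable pairs.\<close>
  have "\<exists>(G, X, s) \<in> instances H 2 n. real (bits_used A p X s) \<ge> 1 / 32 * (real n / real p)"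
    if "n \<ge> 4" "p \<ge> 1" and A: "solves_connectivity A p (instances H 2 n)" for n p A
  proof -
    \<comment> \<open>The index 0 is left out because the pair {0, 1} holds the hubs.\<close>
    define F where "F = Pow {1..<n div 2}"
    define a' where "a' S = disj_stream n S (filter even [0..<n])" for S
    \<comment> \<open>Encoding the complement turns disjointness into inclusion: the diagonal inputs
      are connected, and two connected exchanged inputs would force equality by
      antisymmetry.\<close>
    define b' where "b' S = disj_stream n ({1..<n div 2} - S) (filter odd [0..<n])" for S
    have inst: "(disj_graph n S ({1..<n div 2} - T), {0, 1}, a' S @ b' T) \<in> instances H 2 n" for S T
    proof -
      have "free_of H (delete_verts (with_proj (disj_graph n S ({1..<n div 2} - T))) {0, 1})"
        by (rule free_of_if_unique_neighbours[OF unique_neighbours_disj_graph vab])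
      moreover have "pverts (disj_graph n S ({1..<n div 2} - T)) = {..<n}"
        by (simp add: disj_graph_def)
      ultimately show ?thesis
        using \<open>n \<ge> 4\<close> is_al_stream_disj pair_graph_disj_graph
        by (auto simp: instances_def a'_def b'_def)
    qed
    have result_iff: "result A p {0, 1} (a' S @ b' T) \<longleftrightarrow> S \<subseteq> T" if "S \<in> F" for S T
    proof -
      have "result A p {0, 1} (a' S @ b' T)
          \<longleftrightarrow> Digraph_Component.connected (with_proj (disj_graph n S ({1..<n div 2} - T)))"
        using A inst[of S T] by (auto simp: solves_connectivity_def)
      also have "\<dots> \<longleftrightarrow> S \<inter> ({1..<n div 2} - T) = {}"
        using \<open>n \<ge> 4\<close> that by (intro connected_disj_graph_iff) (auto simp: F_def)
      also have "\<dots> \<longleftrightarrow> S \<subseteq> T" using that by (auto simp: F_def)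
      finally show ?thesis .
    qed
    have F: "finite F" "F \<noteq> {}" "card F = 2 ^ (n div 2 - 1)"
      by (auto simp: F_def card_Pow)
    \<comment> \<open>The bound for the fooling set is taken as the maximum over its diagonal
      inputs, so that a single instance attains it.\<close>
    define bits where "bits S = bits_used A p {0, 1} (a' S @ b' S)" for S
    obtain S where "S \<in> F" and S: "\<And>T. T \<in> F \<Longrightarrow> bits T \<le> bits S"
      using obtains_MAX[OF F(1,2), of bits] F(1) by (metis Max_ge finite_imageI imageI)
    have len: "length (a' T) = length (a' U) \<and> length (b' T) = length (b' U)" for T U
      by (simp add: a'_def b'_def disj_stream_def)
    have "card F \<le> 2 ^ (4 * p * bits S)"
    proof (rule fooling_set_bound[OF len])
      show "result A p {0, 1} (a' T @ b' T)" if "T \<in> F" for T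
        using that by (simp add: result_iff del: One_nat_def)
      show "\<not> (result A p {0, 1} (a' T @ b' U) \<and> result A p {0, 1} (a' U @ b' T))"
        if "T \<in> F" "U \<in> F" "T \<noteq> U" for T U
        using that by (auto simp add: result_iff simp del: One_nat_def)
      show "bits_used A p {0, 1} (a' T @ b' T) \<le> bits S" if "T \<in> F" for T
        using S[OF that] by (simp only: bits_def)
    qed
    then have "n div 2 - 1 \<le> 4 * p * bits S" by (simp add: F(3))
    moreover have "n \<le> 8 * (n div 2 - 1)" using \<open>n \<ge> 4\<close> by presburger
    ultimately have "n \<le> 32 * (p * bits S)" by linarith
    then have "real n \<le> 32 * (real p * real (bits S))"
      by (metis of_nat_le_iff of_nat_mult of_nat_numeral)
    then have "real (bits S) \<ge> 1 / 32 * (real n / real p)"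
      using \<open>p \<ge> 1\<close> by (simp add: field_simps)
    then show ?thesis using inst[of S S] by (auto simp: bits_def)
  qed
  then show ?thesis
    by (intro exI[of _ 2] exI[of _ "1 / 32"] conjI exI[of _ 4]) auto
qed

end
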